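(* Let $n,c,m$ be positive integers and $a\in\{1,\dots,c\}$. Let $P_{m+1}$ denote the colored pattern $1^a1^a\cdots1^a$ of length $m+1$. Then $$\left|\Pi_n^{eq}\wr C_c(P_{m+1})\right|=\sum_{(p_1,\dots,p_k)\vdash n}\binom{n}{p_1,p_2,\dots,p_k}\prod_{i=1}^n\frac{1}{(\#p(i))!}\prod_{i=1}^k\left(\sum_{\ell_i=0}^m\binom{p_i}{\ell_i}(c-1)^{p_i-\ell_i}\right),$$ where the sum is over all integer partitions $p=(p_1,\dots,p_k)$ of $n$ (multisets of positive integers summing to $n$, $k$ arbitrary) and $\#p(i)$ is the number of parts of $p$ equal to $i$.
   Context: $\Pi_n\wr C_c$ is the set of colored set partitions of $[n]$: a set partition of $[n]$ together with an assignment of a color in $\{1,\dots,c\}$ to each element. A colored partition eq-contains $1^a1^a\cdots1^a$ (length $m+1$) iff some block contains at least $m+1$ elements of color $a$; $\Pi_n^{eq}\wr C_c(P_{m+1})$ is the set of those that do not. $\binom{n}{p_1,\dots,p_k}=\frac{n!}{p_1!\cdots p_k!}$. *)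

theory Defs
  imports Complex_Main "HOL-Library.Multiset" "HOL-Library.Disjoint_Sets" "HOL-Library.FuncSet"
begin

type_synonym colored_partition = "nat set set \<times> (nat \<Rightarrow> nat)"

definition colored_partitions :: "nat \<Rightarrow> nat \<Rightarrow> colored_partition set" where
  "colored_partitions n c =
     {(P, f). partition_on {1..n} P \<and> f \<in> {1..n} \<rightarrow>\<^sub>E {1..c}}"

text \<open>
  A host eq-contains a pattern if the subpartition induced on some subset of its ground set is,
  after order-preserving relabelling, the pattern with exactly the same colors.
  The map \<open>h\<close> is the inverse of the relabelling.
\<close>

definition eq_contains :: "colored_partition \<Rightarrow> colored_partition \<Rightarrow> bool" where
  "eq_contains = (\<lambda>(P, f) (Q, g).
     \<exists>h. strict_mono_on (\<Union>Q) h \<and> h ` \<Union>Q \<subseteq> \<Union>P \<and>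
       (\<forall>i\<in>\<Union>Q. \<forall>j\<in>\<Union>Q. (\<exists>B\<in>P. h i \<in> B \<and> h j \<in> B) \<longleftrightarrow> (\<exists>B\<in>Q. i \<in> B \<and> j \<in> B)) \<and>
       (\<forall>i\<in>\<Union>Q. f (h i) = g i))"

definition mono_pattern :: "nat \<Rightarrow> nat \<Rightarrow> colored_partition" where
  "mono_pattern a k = ({{1..k}}, \<lambda>i\<in>{1..k}. a)"

definition eq_avoiders :: "nat \<Rightarrow> nat \<Rightarrow> colored_partition \<Rightarrow> colored_partition set" where
  "eq_avoiders n c p = {s \<in> colored_partitions n c. \<not> eq_contains s p}"

definition integer_partitions :: "nat \<Rightarrow> nat multiset set" where
  "integer_partitions n = {p. (\<forall>x \<in># p. 0 < x) \<and> sum_mset p = n}"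

lemma eq_contains_mono_pattern_iff:
  assumes "(P, f) \<in> colored_partitions n c" and "0 < k"
  shows "eq_contains (P, f) (mono_pattern a k) \<longleftrightarrow> (\<exists>B\<in>P. k \<le> card {x \<in> B. f x = a})"
proof
  have P: "partition_on {1..n} P"
    using assms(1) by (simp add: colored_partitions_def)
  have fin: "finite B" if "B \<in> P" for B
    using partition_onD1[OF P] that by (metis Union_upper finite_atLeastAtMost finite_subset)
  {
    assume "eq_contains (P, f) (mono_pattern a k)"
    then obtain h where h: "strict_mono_on {1..k} h" "h ` {1..k} \<subseteq> \<Union>P"
      "\<And>i j. i \<in> {1..k} \<Longrightarrow> j \<in> {1..k} \<Longrightarrow> \<exists>B\<in>P. h i \<in> B \<and> h j \<in> B"
      "\<And>i. i \<in> {1..k} \<Longrightarrow> f (h i) = a"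
      by (auto simp: eq_contains_def mono_pattern_def)
    have "1 \<in> {1..k}" using assms(2) by simp
    then obtain B where B: "B \<in> P" "h 1 \<in> B" using h(3)[of 1 1] by blast
    have "h j \<in> B" if j: "j \<in> {1..k}" for j
    proof -
      obtain C where C: "C \<in> P" "h 1 \<in> C" "h j \<in> C"
        using h(3)[OF \<open>1 \<in> {1..k}\<close> j] by blast
      have "C = B"
        using disjointD[OF partition_onD2[OF P] C(1) B(1)] B(2) C(2) by blast
      then show ?thesis using C by simp
    qed
    then have "h ` {1..k} \<subseteq> {x \<in> B. f x = a}" using h(4) by auto
    moreover have "card (h ` {1..k}) = k"
      using card_image[OF strict_mono_on_imp_inj_on[OF h(1)]] by simp
    ultimately have "k \<le> card {x \<in> B. f x = a}"
      using card_mono[of "{x \<in> B. f x = a}" "h ` {1..k}"] fin[OF B(1)] by simp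
    then show "\<exists>B\<in>P. k \<le> card {x \<in> B. f x = a}" using B by blast
  next
    assume "\<exists>B\<in>P. k \<le> card {x \<in> B. f x = a}"
    then obtain B where B: "B \<in> P" "k \<le> card {x \<in> B. f x = a}" by blast
    define xs where "xs = sorted_list_of_set {x \<in> B. f x = a}"
    have xs: "sorted_wrt (<) xs" "length xs = card {x \<in> B. f x = a}" "set xs = {x \<in> B. f x = a}"
      using fin[OF B(1)] by (simp_all add: xs_def)
    define h where "h i = xs ! (i - 1)" for i
    have mem: "h i \<in> B \<and> f (h i) = a" if "i \<in> {1..k}" for i
    proof -
      have "i - 1 < length xs" using that B(2) xs(2) by auto
      then have "h i \<in> set xs" by (simp add: h_def)
      then show ?thesis using xs(3) by simp
    qed
    have "strict_mono_on {1..k} h"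
    proof (rule strict_mono_onI)
      fix r s assume rs: "r \<in> {1..k}" "s \<in> {1..k}" "r < s"
      show "h r < h s" unfolding h_def
        by (rule sorted_wrt_nth_less[OF xs(1)]) (use rs B(2) xs(2) in auto)
    qed
    moreover have "h ` {1..k} \<subseteq> \<Union>P" using mem B(1) by blast
    moreover have "\<exists>B\<in>P. h i \<in> B \<and> h j \<in> B" if "i \<in> {1..k}" "j \<in> {1..k}" for i j
      using mem[OF that(1)] mem[OF that(2)] B(1) by blast
    ultimately show "eq_contains (P, f) (mono_pattern a k)"
      unfolding eq_contains_def mono_pattern_def prod.case using mem
      by (intro exI[of _ h]) simp
  }
qed

end

theory Submission
  imports Defs
begin

text \<open>
  Given the underlying set partition, the elements of each block are colored independently of the
  other blocks, so the colorings are counted by a product over the blocks that depends only on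
  their sizes. It remains to count the set partitions with a prescribed multiset of block sizes;
  removing one block of a given size yields a recurrence that is solved by the multinomial
  coefficient divided by the factorials of the multiplicities.
\<close>

section \<open>Block sizes of set partitions\<close>

definition block_sizes :: "'a set set \<Rightarrow> nat multiset" where
  "block_sizes P = image_mset card (mset_set P)"

definition partitions_of_type :: "'a set \<Rightarrow> nat multiset \<Rightarrow> 'a set set set" where
  "partitions_of_type A p = {P. partition_on A P \<and> block_sizes P = p}"

text \<open>The admissible colorings of a single block. Taking them extensional makes a coloring of
  the ground set correspond exactly to the family of its restrictions to the blocks.\<close>

definition bounded_colorings :: "'a set \<Rightarrow> 'b set \<Rightarrow> 'b \<Rightarrow> nat \<Rightarrow> ('a \<Rightarrow> 'b) set" where
  "bounded_colorings B C a m = {f \<in> B \<rightarrow>\<^sub>E C. card {x \<in> B. f x = a} \<le> m}"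

lemma finite_partitions_on:
  assumes "finite A"
  shows "finite {P. partition_on A P}"
  by (rule finite_subset[of _ "Pow (Pow A)"]) (use assms in \<open>auto simp: partition_on_def\<close>)

lemma finite_partitions_of_type:
  assumes "finite A"
  shows "finite (partitions_of_type A p)"
  by (rule finite_subset[OF _ finite_partitions_on[OF assms]]) (auto simp: partitions_of_type_def)

lemma sum_mset_block_sizes:
  assumes "finite A" "partition_on A P"
  shows "sum_mset (block_sizes P) = card A"
proof -
  have "card A = (\<Sum>B\<in>P. card B)"
    using assms finite_subset[of _ A] partition_onD1[OF assms(2)]
    by (subst partition_onD1[OF assms(2)], intro card_Union_disjoint)
       (auto simp: partition_on_def disjoint_def pairwise_def disjnt_def)
  then show ?thesis
    by (simp add: block_sizes_def sum_unfold_sum_mset)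
qed

lemma block_sizes_pos:
  assumes "finite A" "partition_on A P" "x \<in># block_sizes P"
  shows "0 < x"
proof -
  obtain B where B: "B \<in> P" "x = card B"
    using assms finite_elements[OF assms(1,2)] by (auto simp: block_sizes_def)
  then have "finite B" "B \<noteq> {}"
    using assms(1,2) finite_subset[of B A] by (auto simp: partition_on_def)
  then show ?thesis
    using B by (simp add: card_gt_0_iff)
qed

section \<open>Counting set partitions with given block sizes\<close>

lemma card_blocks_of_size:
  assumes "finite P"
  shows "card {B \<in> P. card B = x} = count (block_sizes P) x"
proof -
  have "card -` {x} \<inter> P = {B \<in> P. card B = x}"
    by auto
  then show ?thesis
    using assms by (simp add: block_sizes_def count_image_mset)
qed

lemma block_sizes_insert:
  assumes "finite Q" "B \<notin> Q"
  shows "block_sizes (insert B Q) = add_mset (card B) (block_sizes Q)"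
  using assms by (simp add: block_sizes_def)

text \<open>Both sides count the partitions of type \<open>add_mset x p\<close> with a distinguished block of
  size \<open>x\<close>.\<close>

lemma card_partitions_of_type_add_mset:
  assumes "finite A" "0 < x" "x \<le> card A"
    and N: "\<And>B. B \<subseteq> A \<Longrightarrow> card B = x \<Longrightarrow> card (partitions_of_type (A - B) p) = N"
  shows "card (partitions_of_type A (add_mset x p)) * Suc (count p x) = (card A choose x) * N"
proof -
  let ?L = "SIGMA P:partitions_of_type A (add_mset x p). {B \<in> P. card B = x}"
  let ?R = "SIGMA B:{B. B \<subseteq> A \<and> card B = x}. partitions_of_type (A - B) p"
  have finP: "finite P" if "P \<in> partitions_of_type A q" for P q
    using that finite_elements[OF assms(1)] by (auto simp: partitions_of_type_def)
  have part: "partition_on (A - B) (P - {B}) \<and> B \<subseteq> A" if "partition_on A P" "B \<in> P" for P B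
    using that by (auto simp: partition_on_def disjoint_def)
  have ins: "partition_on A (insert B Q) \<and> B \<notin> Q"
    if "partition_on (A - B) Q" "B \<subseteq> A" "card B = x" for B Q
  proof -
    \<comment> \<open>Positivity of \<open>x\<close> enters here: a nonempty \<open>B\<close>
      disjoint from \<open>\<Union>Q\<close> cannot be a member of \<open>Q\<close>, so removing it
      after insertion gives back \<open>Q\<close>.\<close>
    have "B \<noteq> {}"
      using that(3) assms(2) by auto
    moreover have "\<Union>Q = A - B"
      using that(1) by (simp add: partition_on_def)
    ultimately have "disjnt B (\<Union>Q)" "B \<notin> Q"
      by (auto simp: disjnt_def)
    then show ?thesis
      using partition_on_insert that \<open>B \<noteq> {}\<close> by blast
  qed
  have "bij_betw (\<lambda>(P, B). (B, P - {B})) ?L ?R"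
  proof (rule bij_betw_byWitness[where f' = "\<lambda>(B, Q). (insert B Q, B)"])
    show "\<forall>z\<in>?L. (\<lambda>(B, Q). (insert B Q, B)) ((\<lambda>(P, B). (B, P - {B})) z) = z"
      by auto
    show "\<forall>z\<in>?R. (\<lambda>(P, B). (B, P - {B})) ((\<lambda>(B, Q). (insert B Q, B)) z) = z"
      using ins by (auto simp: partitions_of_type_def)
    show "(\<lambda>(P, B). (B, P - {B})) ` ?L \<subseteq> ?R"
    proof (clarsimp simp: partitions_of_type_def)
      fix P B
      assume P: "partition_on A P" "block_sizes P = add_mset (card B) p" "B \<in> P" "x = card B"
      have "block_sizes P = add_mset (card B) (block_sizes (P - {B}))"
        using block_sizes_insert[of "P - {B}" B] finite_elements[OF assms(1) P(1)] P(3)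
        by (simp add: insert_absorb)
      then show "B \<subseteq> A \<and> partition_on (A - B) (P - {B}) \<and> block_sizes (P - {B}) = p"
        using part[OF P(1,3)] P by simp
    qed
    show "(\<lambda>(B, Q). (insert B Q, B)) ` ?R \<subseteq> ?L"
      using ins finite_elements[of "A - _"] assms(1)
      by (auto simp: partitions_of_type_def block_sizes_insert)
  qed
  then have "card ?L = card ?R"
    by (rule bij_betw_same_card)
  also have "card ?R = (\<Sum>B\<in>{B. B \<subseteq> A \<and> card B = x}. card (partitions_of_type (A - B) p))"
    using assms(1) by (intro card_SigmaI) (auto intro: finite_partitions_of_type)
  also have "\<dots> = (card A choose x) * N"
    using N n_subsets[OF assms(1)] by simp
  also have "card ?L = (\<Sum>P\<in>partitions_of_type A (add_mset x p). card {B \<in> P. card B = x})"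
    using finP by (intro card_SigmaI finite_partitions_of_type assms(1)) auto
  \<comment> \<open>The type alone fixes the number of candidates for the distinguished block: the
    multiplicity of \<open>x\<close> in \<open>add_mset x p\<close>.\<close>
  also have "\<dots> = (\<Sum>P\<in>partitions_of_type A (add_mset x p). Suc (count p x))"
    using finP by (intro sum.cong refl) (auto simp: partitions_of_type_def card_blocks_of_size)
  finally show ?thesis
    by simp
qed

text \<open>Clearing denominators keeps the count within the naturals. The induction removes one
  part at a time; \<open>A\<close> varies because the ground set shrinks to
  \<open>A - B\<close>.\<close>

lemma card_partitions_of_type:
  assumes "finite A" "\<forall>x\<in>#p. 0 < x" "sum_mset p = card A"
  shows "card (partitions_of_type A p) * ((\<Prod>x\<in>#p. fact x) * (\<Prod>i\<in>set_mset p. fact (count p i)))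
    = fact (card A)"
  using assms
proof (induction p arbitrary: A)
  case empty
  then have "partitions_of_type A {#} = {{}}"
    by (auto simp: partitions_of_type_def block_sizes_def partition_on_def mset_set_empty_iff)
  with empty show ?case
    by simp
next
  case (add x p)
  let ?D = "\<lambda>p. (\<Prod>x\<in>#p. fact x) * (\<Prod>i\<in>set_mset p. fact (count p i)) :: nat"
  have le: "x \<le> card A" and x: "0 < x"
    using add.prems by auto
  \<comment> \<open>The recurrence needs one count valid for every \<open>B\<close>. The induction
    hypothesis gives each count times the nonzero number \<open>?D p\<close>, so all of them equal
    this quotient.\<close>
  define N where "N = fact (card A - x) div ?D p"
  have D: "?D p \<noteq> 0"
    by (auto simp: prod_mset_zero_iff)
  have IH: "card (partitions_of_type (A - B) p) * ?D p = fact (card A - x)"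
    if "B \<subseteq> A" "card B = x" for B
    using add.IH[of "A - B"] add.prems that by (simp add: card_Diff_subset finite_subset)
  have N: "card (partitions_of_type (A - B) p) = N" if "B \<subseteq> A" "card B = x" for B
    using IH[OF that] D unfolding N_def by (metis nonzero_mult_div_cancel_right)
  \<comment> \<open>A single block of size \<open>x\<close> suffices to show that the division in
    \<open>N\<close> is exact.\<close>
  obtain B where B: "B \<subseteq> A" "card B = x"
    using le obtain_subset_with_card_n by metis
  have ND: "N * ?D p = fact (card A - x)"
    using IH[OF B] N[OF B] by simp
  \<comment> \<open>The new part contributes \<open>fact x\<close>, and raising its multiplicity by
    one turns \<open>fact (count p x)\<close> into \<open>fact (Suc (count p x))\<close>.\<close>
  have "?D (add_mset x p) = fact x * Suc (count p x) * ?D p"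
  proof -
    let ?S = "set_mset p - {x}"
    have "(\<Prod>i\<in>set_mset (add_mset x p). fact (count (add_mset x p) i) :: nat)
        = fact (Suc (count p x)) * (\<Prod>i\<in>?S. fact (count (add_mset x p) i))"
      by (simp add: prod.insert_remove)
    also have "(\<Prod>i\<in>?S. fact (count (add_mset x p) i) :: nat) = (\<Prod>i\<in>?S. fact (count p i))"
      by (intro prod.cong) auto
    also have "fact (Suc (count p x)) * (\<Prod>i\<in>?S. fact (count p i)) =
        Suc (count p x) * (fact (count p x) * (\<Prod>i\<in>?S. fact (count p i)))"
      by (simp only: fact_Suc of_nat_id mult.assoc)
    \<comment> \<open>If \<open>x\<close> is not a part of \<open>p\<close>, the split-off factor is
      \<open>fact 0 = 1\<close>.\<close>
    also have "fact (count p x) * (\<Prod>i\<in>?S. fact (count p i)) = (\<Prod>i\<in>set_mset p. fact (count p i) :: nat)"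
      using prod.remove[of "set_mset p" x "\<lambda>i. fact (count p i) :: nat"]
      by (cases "x \<in># p") (simp_all add: not_in_iff)
    finally show ?thesis
      by (simp only: image_mset_add_mset prod_mset.add_mset mult_ac)
  qed
  then have "card (partitions_of_type A (add_mset x p)) * ?D (add_mset x p)
      = card (partitions_of_type A (add_mset x p)) * Suc (count p x) * (fact x * ?D p)"
    by (simp only: mult_ac)
  also have "\<dots> = (card A choose x) * N * (fact x * ?D p)"
    using card_partitions_of_type_add_mset[OF add.prems(1) x le N] by simp
  also have "\<dots> = fact x * fact (card A - x) * (card A choose x)"
    unfolding ND[symmetric] by (simp only: mult_ac)
  also have "\<dots> = fact (card A)"
    using binomial_fact_lemma[OF le] .
  finally show ?case .
qed

text \<open>Makes the index set of the final sum the image under which set partitions are grouped.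
  That every integer partition is realized needs no construction: the counting formula equates a
  multiple of the number of realizations with a factorial, so this number is not zero.\<close>

lemma integer_partitions_eq_block_sizes:
  "integer_partitions n = block_sizes ` {P. partition_on {1..n} P}"
proof
  show "block_sizes ` {P. partition_on {1..n} P} \<subseteq> integer_partitions n"
    using sum_mset_block_sizes[of "{1..n}"] block_sizes_pos[of "{1..n}"]
    by (auto simp: integer_partitions_def)
  show "integer_partitions n \<subseteq> block_sizes ` {P. partition_on {1..n} P}"
  proof
    fix p assume "p \<in> integer_partitions n"
    then have "card (partitions_of_type {1..n} p) \<noteq> 0"
      using card_partitions_of_type[of "{1..n}" p]
      by (intro notI) (simp add: integer_partitions_def)
    then show "p \<in> block_sizes ` {P. partition_on {1..n} P}"
      by (auto simp: partitions_of_type_def card_eq_0_iff)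
  qed
qed

section \<open>Counting colorings block by block\<close>

text \<open>Colorings are classified by the set \<open>S\<close> of elements of color
  \<open>a\<close>; every other element freely takes one of the remaining colors. For
  \<open>l\<close> above \<open>card B\<close> the binomial coefficient vanishes, so the truncated
  exponent does no harm.\<close>

lemma card_bounded_colorings:
  assumes "finite B" "finite C" "a \<in> C"
  shows "card (bounded_colorings B C a m) =
    (\<Sum>l=0..m. (card B choose l) * (card C - 1) ^ (card B - l))"
proof -
  let ?F = "\<lambda>S. {f \<in> B \<rightarrow>\<^sub>E C. {x \<in> B. f x = a} = S}"
  have F: "card (?F S) = (card C - 1) ^ (card B - card S)" if "S \<subseteq> B" for S
  proof -
    \<comment> \<open>Once \<open>S\<close> is prescribed, the values at different points are chosen
      independently.\<close>
    have "?F S = (\<Pi>\<^sub>E x\<in>B. if x \<in> S then {a} else C - {a})"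
      using that assms(3) by (auto simp: PiE_iff extensional_def split: if_splits)
    then have "card (?F S) = (\<Prod>x\<in>B. if x \<in> S then 1 else card C - 1)"
      using assms by (simp add: card_PiE if_distrib cong: if_cong)
    also have "\<dots> = (\<Prod>x\<in>B - S. card C - 1)"
      using assms(1) by (intro prod.mono_neutral_cong_right) auto
    finally show ?thesis
      using that assms(1) by (simp add: card_Diff_subset finite_subset)
  qed
  have fin: "finite (?F S)" for S
    using assms by (auto intro: finite_subset[OF _ finite_PiE[of B "\<lambda>_. C"]])
  have "bounded_colorings B C a m = (\<Union>l\<in>{0..m}. \<Union>S\<in>{S. S \<subseteq> B \<and> card S = l}. ?F S)"
    by (auto simp: bounded_colorings_def)
  also have "card \<dots> = (\<Sum>l=0..m. card (\<Union>S\<in>{S. S \<subseteq> B \<and> card S = l}. ?F S))"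
    using assms(1) fin by (intro card_UN_disjoint) auto
  also have "\<dots> = (\<Sum>l=0..m. \<Sum>S\<in>{S. S \<subseteq> B \<and> card S = l}. card (?F S))"
    using assms(1) fin by (intro sum.cong refl card_UN_disjoint) auto
  also have "\<dots> = (\<Sum>l=0..m. (card B choose l) * (card C - 1) ^ (card B - l))"
    using F n_subsets[OF assms(1)] by (intro sum.cong refl) simp
  finally show ?thesis .
qed

text \<open>Restricting to the blocks and gluing along them are mutually inverse, which identifies
  the functions on \<open>A\<close> with families of functions on the blocks.\<close>

lemma card_blockwise_functions:
  assumes "finite A" "partition_on A P" and F: "\<And>B. B \<in> P \<Longrightarrow> F B \<subseteq> B \<rightarrow>\<^sub>E C"
  shows "card {f \<in> A \<rightarrow>\<^sub>E C. \<forall>B\<in>P. restrict f B \<in> F B} = (\<Prod>B\<in>P. card (F B))"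
proof -
  let ?S = "{f \<in> A \<rightarrow>\<^sub>E C. \<forall>B\<in>P. restrict f B \<in> F B}"
  define blk where "blk x = (THE B. B \<in> P \<and> x \<in> B)" for x
  have blk: "blk x = B" if "B \<in> P" "x \<in> B" for x B
    unfolding blk_def using that assms(2)
    by (intro the_equality) (auto simp: partition_on_def disjoint_def)
  have A: "A = \<Union>P"
    using assms(2) by (simp add: partition_on_def)
  let ?g = "\<lambda>g. \<lambda>x\<in>A. g (blk x) x"
  \<comment> \<open>Gluing and then restricting returns the original member; outside
    \<open>B\<close> both sides are \<open>undefined\<close>, since \<open>g B\<close> is
    extensional.\<close>
  have res: "restrict (?g g) B = g B" if g: "g \<in> Pi\<^sub>E P F" and B: "B \<in> P" for g B
  proof
    fix x
    have "g B \<in> B \<rightarrow>\<^sub>E C"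
      using g B F by (meson PiE_mem subsetD)
    then show "restrict (?g g) B x = g B x"
      using blk[OF B, of x] PiE_arb[of "g B" B "\<lambda>_. C" x] B A by (cases "x \<in> B") auto
  qed
  have "bij_betw (\<lambda>f. \<lambda>B\<in>P. restrict f B) ?S (Pi\<^sub>E P F)"
  proof (rule bij_betw_byWitness[where f' = ?g])
    show "\<forall>f\<in>?S. ?g (\<lambda>B\<in>P. restrict f B) = f"
    proof
      fix f assume "f \<in> ?S"
      then have f: "f \<in> A \<rightarrow>\<^sub>E C"
        by simp
      show "?g (\<lambda>B\<in>P. restrict f B) = f"
      proof
        fix x
        show "?g (\<lambda>B\<in>P. restrict f B) x = f x"
        proof (cases "x \<in> A")
          case True
          then obtain B where "B \<in> P" "x \<in> B"
            using A by blast
          then show ?thesis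
            using True blk[of B x] by simp
        next
          case False
          then show ?thesis
            using PiE_arb[OF f False] by simp
        qed
      qed
    qed
    show "\<forall>g\<in>Pi\<^sub>E P F. (\<lambda>B\<in>P. restrict (?g g) B) = g"
    proof
      fix g assume g: "g \<in> Pi\<^sub>E P F"
      show "(\<lambda>B\<in>P. restrict (?g g) B) = g"
      proof
        fix B
        show "(\<lambda>B\<in>P. restrict (?g g) B) B = g B"
          using res[OF g, of B] PiE_arb[OF g, of B] by (cases "B \<in> P") simp_all
      qed
    qed
    show "(\<lambda>f. \<lambda>B\<in>P. restrict f B) ` ?S \<subseteq> Pi\<^sub>E P F"
      by auto
    show "?g ` Pi\<^sub>E P F \<subseteq> ?S"
    proof clarify
      fix g assume g: "g \<in> Pi\<^sub>E P F"
      have "g (blk x) x \<in> C" if x: "x \<in> A" for x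
      proof -
        obtain B where B: "B \<in> P" "x \<in> B"
          using x A by blast
        then have "g B \<in> B \<rightarrow>\<^sub>E C"
          using g F by (meson PiE_mem subsetD)
        then show ?thesis
          using B blk by auto
      qed
      moreover have "restrict (?g g) B \<in> F B" if "B \<in> P" for B
        using res[OF g that] g that by (metis PiE_mem)
      ultimately show "?g g \<in> A \<rightarrow>\<^sub>E C \<and> (\<forall>B\<in>P. restrict (?g g) B \<in> F B)"
        by simp
    qed
  qed
  then show ?thesis
    using finite_elements[OF assms(1,2)] by (simp add: bij_betw_same_card card_PiE)
qed

section \<open>Avoiders as set partitions with admissible colorings\<close>

text \<open>Avoidance of a one-block, one-color pattern is a condition on each block separately, so
  the avoiders over a fixed \<open>P\<close> are counted by a product over its blocks, whose factors
  depend only on block sizes.\<close>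

lemma card_eq_avoiders_mono_pattern:
  assumes "a \<in> {1..c}"
  shows "card (eq_avoiders n c (mono_pattern a (m + 1))) =
    (\<Sum>P | partition_on {1..n} P.
      \<Prod>x\<in>#block_sizes P. \<Sum>l=0..m. (x choose l) * (c - 1) ^ (x - l))"
proof -
  let ?F = "\<lambda>B. bounded_colorings B {1..c} a m"
  let ?G = "\<lambda>P. {f \<in> {1..n} \<rightarrow>\<^sub>E {1..c}. \<forall>B\<in>P. restrict f B \<in> ?F B}"
  have restrict: "restrict f B \<in> ?F B \<longleftrightarrow> card {x \<in> B. f x = a} \<le> m"
    if "f \<in> {1..n} \<rightarrow>\<^sub>E {1..c}" "B \<subseteq> {1..n}" for f :: "nat \<Rightarrow> nat" and B
  proof -
    have "{x \<in> B. restrict f B x = a} = {x \<in> B. f x = a}"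
      by auto
    moreover have "restrict f B \<in> B \<rightarrow>\<^sub>E {1..c}"
      using that by (auto simp: PiE_iff subset_iff)
    ultimately show ?thesis
      by (simp add: bounded_colorings_def)
  qed
  have sub: "B \<subseteq> {1..n}" if "partition_on {1..n} P" "B \<in> P" for B P
    using partition_onD1[OF that(1)] that(2) by blast
  have "(P, f) \<in> eq_avoiders n c (mono_pattern a (m + 1)) \<longleftrightarrow>
      partition_on {1..n} P \<and> f \<in> ?G P" for P f
  proof (cases "(P, f) \<in> colored_partitions n c")
    case True
    then have Pf: "partition_on {1..n} P" "f \<in> {1..n} \<rightarrow>\<^sub>E {1..c}"
      by (auto simp: colored_partitions_def)
    \<comment> \<open>The pattern has length \<open>m + 1\<close>, so avoiding it allows at most
      \<open>m\<close> elements of color \<open>a\<close> in each block.\<close>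
    have "(P, f) \<in> eq_avoiders n c (mono_pattern a (m + 1)) \<longleftrightarrow>
        (\<forall>B\<in>P. card {x \<in> B. f x = a} \<le> m)"
      using True eq_contains_mono_pattern_iff[OF True, of "m + 1" a]
      by (auto simp: eq_avoiders_def not_le less_Suc_eq_le)
    then show ?thesis
      using Pf restrict[OF Pf(2) sub[OF Pf(1)]] by auto
  next
    case False
    then show ?thesis
      by (auto simp: eq_avoiders_def colored_partitions_def)
  qed
  then have "eq_avoiders n c (mono_pattern a (m + 1)) = (SIGMA P:{P. partition_on {1..n} P}. ?G P)"
    by auto
  moreover have "finite (?G P)" for P
    by (rule finite_subset[OF _ finite_PiE[of "{1..n}" "\<lambda>_. {1..c}"]]) auto
  ultimately have "card (eq_avoiders n c (mono_pattern a (m + 1))) =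
      (\<Sum>P | partition_on {1..n} P. card (?G P))"
    by (simp add: card_SigmaI finite_partitions_on)
  also have "\<dots> = (\<Sum>P | partition_on {1..n} P.
      \<Prod>x\<in>#block_sizes P. \<Sum>l=0..m. (x choose l) * (c - 1) ^ (x - l))"
  proof (intro sum.cong refl)
    fix P assume "P \<in> {P. partition_on {1..n} P}"
    then have P: "partition_on {1..n} P"
      by simp
    have "card (?G P) = (\<Prod>B\<in>P. card (?F B))"
      by (rule card_blockwise_functions[OF _ P]) (auto simp: bounded_colorings_def)
    also have "\<dots> = (\<Prod>B\<in>P. \<Sum>l=0..m. (card B choose l) * (c - 1) ^ (card B - l))"
    proof (intro prod.cong refl)
      fix B assume "B \<in> P"
      then have "finite B"
        using sub[OF P] finite_subset by blast
      then show "card (?F B) = (\<Sum>l=0..m. (card B choose l) * (c - 1) ^ (card B - l))"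
        using card_bounded_colorings[of B "{1..c}" a m] assms by simp
    qed
    also have "\<dots> = (\<Prod>x\<in>#block_sizes P. \<Sum>l=0..m. (x choose l) * (c - 1) ^ (x - l))"
      by (simp add: block_sizes_def prod_unfold_prod_mset multiset.map_comp comp_def)
    finally show "card (?G P) = \<dots>" .
  qed
  finally show ?thesis .
qed

section \<open>Passage to real numbers and the final formula\<close>

lemma of_nat_prod_mset_image:
  "of_nat (\<Prod>x\<in>#p. f x) = (\<Prod>x\<in>#p. of_nat (f x) :: 'a :: comm_semiring_1)"
  by (induction p) auto

lemma real_card_partitions_of_type:
  assumes "p \<in> integer_partitions n"
  shows "real (card (partitions_of_type {1..n} p)) =
    fact n / (\<Prod>x\<in>#p. fact x) * (\<Prod>i=1..n. 1 / fact (count p i))"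
proof -
  have p: "\<forall>x\<in>#p. 0 < x" "sum_mset p = n"
    using assms by (auto simp: integer_partitions_def)
  have "x \<le> n" if "x \<in># p" for x
    using p(2) multi_member_split[OF that] by auto
  then have sub: "set_mset p \<subseteq> {1..n}"
    using p(1) by (auto simp: Suc_le_eq)
  \<comment> \<open>An index that is not a part has multiplicity 0 and contributes
    \<open>fact 0 = 1\<close>.\<close>
  have prod_eq: "(\<Prod>i\<in>set_mset p. fact (count p i)) = (\<Prod>i=1..n. fact (count p i) :: real)"
    using sub by (intro prod.mono_neutral_left) (auto simp: not_in_iff)
  have nz: "(\<Prod>x\<in>#p. fact x :: real) \<noteq> 0" "(\<Prod>i=1..n. fact (count p i) :: real) \<noteq> 0"
    by (auto simp: prod_mset_zero_iff)
  have "real (card (partitions_of_type {1..n} p) *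
      ((\<Prod>x\<in>#p. fact x) * (\<Prod>i\<in>set_mset p. fact (count p i)))) = fact n"
    using card_partitions_of_type[of "{1..n}" p] p by simp
  then have "real (card (partitions_of_type {1..n} p)) *
      ((\<Prod>x\<in>#p. fact x) * (\<Prod>i=1..n. fact (count p i))) = fact n"
    by (simp add: of_nat_prod_mset_image prod_eq)
  then show ?thesis
    using nz by (simp add: prod_dividef divide_simps mult_ac)
qed

theorem theorem5p1:
  fixes n c m a :: nat
  assumes "0 < n" and "0 < c" and "0 < m" and "a \<in> {1..c}"
  shows "real (card (eq_avoiders n c (mono_pattern a (m + 1)))) =
    (\<Sum>p\<in>integer_partitions n.
       fact n / (\<Prod>x\<in>#p. fact x)
       * (\<Prod>i=1..n. 1 / fact (count p i))
       * (\<Prod>x\<in>#p. \<Sum>l=0..m. real (x choose l) * (real c - 1) ^ (x - l)))"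
proof -
  let ?W = "\<lambda>p. \<Prod>x\<in>#p. \<Sum>l=0..m. (x choose l) * (c - 1) ^ (x - l)"
  \<comment> \<open>Since \<open>c\<close> is positive, the truncated \<open>c - 1\<close> agrees
    with the real difference.\<close>
  have W: "real (?W p) = (\<Prod>x\<in>#p. \<Sum>l=0..m. real (x choose l) * (real c - 1) ^ (x - l))" for p
    using assms(2) by (simp add: of_nat_prod_mset_image of_nat_diff)
  have "card (eq_avoiders n c (mono_pattern a (m + 1))) =
      (\<Sum>P | partition_on {1..n} P. ?W (block_sizes P))"
    by (rule card_eq_avoiders_mono_pattern[OF assms(4)])
  \<comment> \<open>Set partitions are grouped by type; the summand is constant on each
    group.\<close>
  also have "\<dots> = (\<Sum>p\<in>integer_partitions n. \<Sum>P\<in>partitions_of_type {1..n} p. ?W (block_sizes P))"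
    unfolding integer_partitions_eq_block_sizes
    by (subst sum.image_gen[OF finite_partitions_on, of _ _ block_sizes])
       (auto simp: partitions_of_type_def)
  also have "\<dots> = (\<Sum>p\<in>integer_partitions n. card (partitions_of_type {1..n} p) * ?W p)"
    by (intro sum.cong refl) (simp add: partitions_of_type_def)
  finally have "real (card (eq_avoiders n c (mono_pattern a (m + 1)))) =
      (\<Sum>p\<in>integer_partitions n. real (card (partitions_of_type {1..n} p)) * real (?W p))"
    by (simp only: of_nat_sum of_nat_mult)
  also have "\<dots> = (\<Sum>p\<in>integer_partitions n.
       fact n / (\<Prod>x\<in>#p. fact x)
       * (\<Prod>i=1..n. 1 / fact (count p i))
       * (\<Prod>x\<in>#p. \<Sum>l=0..m. real (x choose l) * (real c - 1) ^ (x - l)))"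
    by (intro sum.cong refl) (simp only: W real_card_partitions_of_type)
  finally show ?thesis .
qed

end
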